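(* Let $N=\{1,\dots,n\}$. For every permutation $\sigma$ of $N$, every game $v$ on $N$ and every integer $k$ with $2\le k\le n$, $$p^\sigma(\mathsf{C}^k(v))=\Big\{x\in\mathsf{PI}(v)\ \Big|\ \sum_{j=1}^i x_{\sigma(j)}\ge v(\{\sigma(1),\dots,\sigma(i)\}),\ i=1,\dots,n-1\Big\},$$ where $p^\sigma(\mathsf{C}^k(v))=\{p^\sigma(\phi)\mid\phi\in\mathsf{C}^k(v)\}$.
   Context: A game on $N=\{1,\dots,n\}$ is a function $v:2^N\to\mathbb{R}$ with $v(\emptyset)=0$. Its Möbius transform is $m^v(S)=\sum_{T\subseteq S}(-1)^{|S\setminus T|}v(T)$. $\mathcal{G}^k(N)$ is the set of at most $k$-additive games, i.e. games $\phi$ with $m^\phi(S)=0$ whenever $|S|>k$. The $k$-additive core of $v$ is $\mathsf{C}^k(v)=\{\phi\in\mathcal{G}^k(N)\mid \phi(S)\ge v(S)\ \forall S\subsetneq N,\ \phi(N)=v(N)\}$. The preimputation set is $\mathsf{PI}(v)=\{x\in\mathbb{R}^n\mid \sum_{i\in N}x_i=v(N)\}$. For a permutation $\sigma$ of $N$, the marginal value $p^\sigma$ maps a game $\phi$ to the vector $p^\sigma(\phi)\in\mathbb{R}^n$ with $p^\sigma_{\sigma(i)}(\phi)=\phi(S_i)-\phi(S_{i-1})$, $i\in N$, where $S_i=\{\sigma(1),\dots,\sigma(i)\}$ and $S_0=\emptyset$. *)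

theory Defs
  imports Complex_Main "HOL-Library.FuncSet" "HOL-Combinatorics.Permutations"
begin

text \<open>
  The ground set is \<open>N = {1..n}\<close>. Functions with domain \<open>Pow N\<close> (games) and vectors indexed by
  \<open>N\<close> are represented extensionally, i.e. they are \<open>undefined\<close> outside their domain, so that
  equality of HOL functions coincides with equality on the domain.
\<close>

definition games :: "nat \<Rightarrow> (nat set \<Rightarrow> real) set" where
  "games n = {v \<in> extensional (Pow {1..n}). v {} = 0}"

definition moebius :: "(nat set \<Rightarrow> real) \<Rightarrow> nat set \<Rightarrow> real" where
  "moebius v S = (\<Sum>T\<in>Pow S. (-1) ^ card (S - T) * v T)"

definition additive_games :: "nat \<Rightarrow> nat \<Rightarrow> (nat set \<Rightarrow> real) set" where
  "additive_games n k = {\<phi> \<in> games n. \<forall>S\<subseteq>{1..n}. card S > k \<longrightarrow> moebius \<phi> S = 0}"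

definition additive_core :: "nat \<Rightarrow> nat \<Rightarrow> (nat set \<Rightarrow> real) \<Rightarrow> (nat set \<Rightarrow> real) set" where
  "additive_core n k v =
     {\<phi> \<in> additive_games n k. (\<forall>S. S \<subset> {1..n} \<longrightarrow> \<phi> S \<ge> v S) \<and> \<phi> {1..n} = v {1..n}}"

definition preimputations :: "nat \<Rightarrow> (nat set \<Rightarrow> real) \<Rightarrow> (nat \<Rightarrow> real) set" where
  "preimputations n v = {x \<in> extensional {1..n}. (\<Sum>i\<in>{1..n}. x i) = v {1..n}}"

text \<open>
  The coordinate \<open>\<sigma> i\<close> of the marginal vector is \<open>\<phi> (\<sigma> ` {1..i}) - \<phi> (\<sigma> ` {1..i - 1})\<close>; hence
  coordinate \<open>j\<close> is obtained by taking \<open>i = inv \<sigma> j\<close>, as confirmed by the lemma below.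
\<close>

definition marginal_value :: "nat \<Rightarrow> (nat \<Rightarrow> nat) \<Rightarrow> (nat set \<Rightarrow> real) \<Rightarrow> nat \<Rightarrow> real" where
  "marginal_value n \<sigma> \<phi> =
     (\<lambda>j\<in>{1..n}. \<phi> (\<sigma> ` {1..inv \<sigma> j}) - \<phi> (\<sigma> ` {1..inv \<sigma> j - 1}))"

lemma marginal_value_perm:
  assumes "\<sigma> permutes {1..n}" and "i \<in> {1..n}"
  shows "marginal_value n \<sigma> \<phi> (\<sigma> i) = \<phi> (\<sigma> ` {1..i}) - \<phi> (\<sigma> ` {1..i - 1})"
  unfolding marginal_value_def
  using permutes_in_image[OF assms(1), of i] permutes_inverses(2)[OF assms(1), of i] assms(2)
  by (simp only: restrict_apply if_True)

end

theory Submission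
  imports Defs
begin

text \<open>
  The inclusion from left to right is telescoping. Conversely, given \<open>x\<close>, start from the additive
  game of \<open>x\<close> and add a large multiple of the game counting the \<open>i\<close> with \<open>\<sigma> (i + 1) \<in> S\<close> and
  \<open>\<sigma> i \<notin> S\<close>. This count is 2-additive, vanishes on the chain of the \<open>\<sigma> ` {1..i}\<close>, and is at
  least 1 on every other coalition, so there the core constraints hold for a large multiple.
\<close>

text \<open>Subsets of \<open>S\<close> pair off as \<open>T\<close> and \<open>insert a T\<close>
  with \<open>a\<close> not in \<open>T\<close>. The values of \<open>f\<close> agree on a pair and
  the signs are opposite, so every pair cancels.\<close>

lemma moebius_eq_0_if_indep:
  assumes "finite S" "a \<in> S" and indep: "\<And>T. T \<subseteq> S - {a} \<Longrightarrow> f (insert a T) = f T"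
  shows "moebius f S = 0"
proof -
  let ?R = "S - {a}"
  have Pow: "Pow S = Pow ?R \<union> insert a ` Pow ?R"
    using Pow_insert[of a ?R] by (simp only: insert_Diff[OF assms(2)])
  have fin: "finite (Pow ?R)" using assms(1) by simp
  have inj: "inj_on (insert a) (Pow ?R)" by (auto simp: inj_on_def)
  have dis: "Pow ?R \<inter> insert a ` Pow ?R = {}" by auto
  have sgn: "(-1::real) ^ card (S - T) = - ((-1) ^ card (S - insert a T))" if "T \<in> Pow ?R" for T
  proof -
    have "insert a (S - insert a T) = S - T" using that assms(2) by auto
    moreover have "card (insert a (S - insert a T)) = Suc (card (S - insert a T))"
      using assms(1) by (intro card_insert_disjoint) auto
    ultimately have "card (S - T) = Suc (card (S - insert a T))" by (simp only:)
    then show ?thesis by simp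
  qed
  have "moebius f S = (\<Sum>T\<in>Pow ?R \<union> insert a ` Pow ?R. (-1) ^ card (S - T) * f T)"
    by (simp only: moebius_def Pow)
  also have "\<dots> = (\<Sum>T\<in>Pow ?R. (-1) ^ card (S - T) * f T)
      + (\<Sum>T\<in>Pow ?R. (-1) ^ card (S - insert a T) * f (insert a T))"
    by (simp only: sum.union_disjoint[OF fin finite_imageI[OF fin] dis] sum.reindex[OF inj] comp_def)
  also have "\<dots> = (\<Sum>T\<in>Pow ?R. (-1) ^ card (S - T) * f T + (-1) ^ card (S - insert a T) * f (insert a T))"
    by (simp only: sum.distrib)
  also have "\<dots> = 0"
    by (rule sum.neutral) (use sgn indep in auto)
  finally show ?thesis .
qed

lemma moebius_sum: "moebius (\<lambda>T. \<Sum>i\<in>I. f i T) S = (\<Sum>i\<in>I. moebius (f i) S)"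
  unfolding moebius_def sum_distrib_left by (rule sum.swap)

lemma moebius_cong: "(\<And>T. T \<subseteq> S \<Longrightarrow> f T = g T) \<Longrightarrow> moebius f S = moebius g S"
  unfolding moebius_def by (auto intro: sum.cong)

lemma sum_marginal_value:
  assumes \<sigma>: "\<sigma> permutes {1..n}" and "\<phi> {} = 0" "i \<le> n"
  shows "(\<Sum>j=1..i. marginal_value n \<sigma> \<phi> (\<sigma> j)) = \<phi> (\<sigma> ` {1..i})"
  using assms(3)
proof (induction i)
  case 0
  show ?case using assms(2) by simp
next
  case (Suc i)
  then show ?case using marginal_value_perm[OF \<sigma>, of "Suc i" \<phi>] by simp
qed

text \<open>The core bounds only proper coalitions, so each prefix with \<open>i < n\<close> must be
  seen to be proper.\<close>

lemma permutes_prefix_psubset: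
  assumes \<sigma>: "\<sigma> permutes {1..n}" and "i < n"
  shows "\<sigma> ` {1..i} \<subset> {1..n::nat}"
proof -
  have "\<sigma> ` {1..i} \<subset> \<sigma> ` {1..n}"
    using permutes_inj[OF \<sigma>] assms(2) by (intro image_strict_mono) (auto intro: inj_on_subset)
  then show ?thesis by (simp only: permutes_image[OF \<sigma>])
qed

text \<open>The positions of the members of \<open>S\<close> form an initial segment. Read
  contrapositively, a coalition off the chain has a player whose immediate predecessor is missing.
  At \<open>i = n\<close> the hypothesis \<open>down\<close> is vacuous, since
  \<open>\<sigma> (Suc n) = Suc n\<close> is not in \<open>S\<close>.\<close>

lemma prefix_if_downward_closed:
  assumes \<sigma>: "\<sigma> permutes {1..n}" and S: "S \<subseteq> {1..n::nat}"
    and down: "\<And>i. i \<in> {1..n} \<Longrightarrow> \<sigma> (Suc i) \<in> S \<Longrightarrow> \<sigma> i \<in> S"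
  obtains m where "m \<le> n" "S = \<sigma> ` {1..m}"
proof (cases "S = {}")
  case True
  then show ?thesis using that[of 0] by simp
next
  case False
  define P where "P = {i \<in> {1..n}. \<sigma> i \<in> S}"
  have "S \<subseteq> \<sigma> ` {1..n}" using S by (simp only: permutes_image[OF \<sigma>])
  then have SP: "S = \<sigma> ` P" unfolding P_def by blast
  have fin: "finite P" by (simp add: P_def)
  have ne: "P \<noteq> {}" using SP False by blast
  have MP: "Max P \<in> P" using fin ne by (rule Max_in)
  have "i \<in> P" if "1 \<le> i" "i \<le> Max P" for i
    \<comment> \<open>Descend from the largest position: \<open>down\<close> passes membership from
      \<open>Suc j\<close> to \<open>j\<close>.\<close>
    using that(2,1)
  proof (induction i rule: inc_induct)
    case base
    show ?case using MP .
  next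
    case (step j)
    then show ?case using down[of j] unfolding P_def by auto
  qed
  moreover have "1 \<le> i \<and> i \<le> Max P" if "i \<in> P" for i
    using that fin unfolding P_def by auto
  ultimately have "P = {1..Max P}" by (intro set_eqI) (metis atLeastAtMost_iff)
  then have "S = \<sigma> ` {1..Max P}" using SP by metis
  moreover have "Max P \<le> n" using MP by (simp add: P_def)
  ultimately show ?thesis by (intro that)
qed

text \<open>Letting \<open>i\<close> reach \<open>n\<close> is harmless: for a permutation of
  \<open>{1..n}\<close>, \<open>\<sigma> (Suc n) = Suc n\<close> lies in no coalition, so the last
  penalty is zero. Keeping both terms under one sum makes each summand depend on \<open>S\<close>
  through two players only.\<close>

definition penalized_game :: "nat \<Rightarrow> (nat \<Rightarrow> nat) \<Rightarrow> (nat \<Rightarrow> real) \<Rightarrow> real \<Rightarrow> nat set \<Rightarrow> real" where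
  "penalized_game n \<sigma> x C = (\<lambda>S\<in>Pow {1..n}. \<Sum>i\<in>{1..n}.
     x (\<sigma> i) * of_bool (\<sigma> i \<in> S) + C * of_bool (\<sigma> (Suc i) \<in> S \<and> \<sigma> i \<notin> S))"

text \<open>The Moebius transform is linear, so one summand suffices. It looks only at
  \<open>\<sigma> i\<close> and \<open>\<sigma> (Suc i)\<close>, and a coalition of more than
  \<open>k \<ge> 2\<close> players contains a third one that it ignores.\<close>

lemma penalized_game_additive:
  assumes "2 \<le> k"
  shows "penalized_game n \<sigma> x C \<in> additive_games n k"
proof -
  let ?f = "\<lambda>i S. x (\<sigma> i) * of_bool (\<sigma> i \<in> S) + C * of_bool (\<sigma> (Suc i) \<in> S \<and> \<sigma> i \<notin> S)"
  have "moebius (penalized_game n \<sigma> x C) S = 0" if S: "S \<subseteq> {1..n}" "k < card S" for S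
  proof -
    have finS: "finite S" using S(1) by (rule finite_subset) simp
    have "moebius (?f i) S = 0" for i
    proof -
      have "card {\<sigma> i, \<sigma> (Suc i)} \<le> 2" by (simp add: card_insert_if)
      then have "\<not> S \<subseteq> {\<sigma> i, \<sigma> (Suc i)}"
        using card_mono[of "{\<sigma> i, \<sigma> (Suc i)}" S] S(2) assms by auto
      then obtain a where "a \<in> S" "a \<noteq> \<sigma> i" "a \<noteq> \<sigma> (Suc i)" by blast
      then show ?thesis using finS by (intro moebius_eq_0_if_indep[of S a]) auto
    qed
    then have "moebius (\<lambda>T. \<Sum>i\<in>{1..n}. ?f i T) S = 0" by (simp only: moebius_sum sum.neutral_const)
    moreover have "moebius (penalized_game n \<sigma> x C) S = moebius (\<lambda>T. \<Sum>i\<in>{1..n}. ?f i T) S"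
      using S(1) by (intro moebius_cong) (auto simp: penalized_game_def)
    ultimately show ?thesis by simp
  qed
  then show ?thesis by (auto simp: additive_games_def games_def penalized_game_def)
qed

lemma penalized_game_prefix:
  assumes \<sigma>: "\<sigma> permutes {1..n}" and "i \<le> n"
  shows "penalized_game n \<sigma> x C (\<sigma> ` {1..i}) = (\<Sum>j=1..i. x (\<sigma> j))"
proof -
  have mem: "\<sigma> j \<in> \<sigma> ` {1..i} \<longleftrightarrow> 1 \<le> j \<and> j \<le> i" for j
    using inj_image_mem_iff[OF permutes_inj[OF \<sigma>], of j "{1..i}"] by simp
  have sub: "\<sigma> ` {1..i} \<in> Pow {1..n}"
    using permutes_image[OF \<sigma>] image_mono[of "{1..i}" "{1..n}" \<sigma>] assms(2) by auto
  have "penalized_game n \<sigma> x C (\<sigma> ` {1..i}) = (\<Sum>j\<in>{1..n}. if j \<in> {1..i} then x (\<sigma> j) else 0)"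
    \<comment> \<open>Penalties vanish because \<open>Suc j \<le> i\<close> forces
      \<open>j \<le> i\<close>, and the sum starts at \<open>j = 1\<close>; position 0 would have
      counted as missing.\<close>
    unfolding penalized_game_def restrict_apply'[OF sub] mem by (intro sum.cong) auto
  also have "\<dots> = (\<Sum>j\<in>{1..n} \<inter> {1..i}. x (\<sigma> j))"
    by (rule sum.inter_restrict[symmetric]) simp
  also have "{1..n} \<inter> {1..i} = {1..i}" using assms(2) by auto
  finally show ?thesis .
qed

text \<open>One missing predecessor already pays \<open>C\<close>, and the other penalties are
  nonnegative. The additive part loses at most the sum of the absolute values of
  \<open>x\<close>.\<close>

lemma penalized_game_ge:
  assumes "0 \<le> C" "S \<subseteq> {1..n}" "i \<in> {1..n}" "\<sigma> (Suc i) \<in> S" "\<sigma> i \<notin> S"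
  shows "C - (\<Sum>j\<in>{1..n}. \<bar>x (\<sigma> j)\<bar>) \<le> penalized_game n \<sigma> x C S"
proof -
  have "C \<le> (\<Sum>j\<in>{1..n}. C * of_bool (\<sigma> (Suc j) \<in> S \<and> \<sigma> j \<notin> S))"
    using member_le_sum[of i "{1..n}" "\<lambda>j. C * of_bool (\<sigma> (Suc j) \<in> S \<and> \<sigma> j \<notin> S)"] assms by simp
  moreover have "- (\<Sum>j\<in>{1..n}. \<bar>x (\<sigma> j)\<bar>) \<le> (\<Sum>j\<in>{1..n}. x (\<sigma> j) * of_bool (\<sigma> j \<in> S))"
    unfolding sum_negf[symmetric] by (intro sum_mono) auto
  ultimately show ?thesis using assms(2) by (simp add: penalized_game_def sum.distrib)
qed

lemma marginal_value_penalized_game: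
  assumes \<sigma>: "\<sigma> permutes {1..n}" and "x \<in> extensional {1..n}"
  shows "marginal_value n \<sigma> (penalized_game n \<sigma> x C) = x"
proof (rule extensionalityI[of _ "{1..n}"])
  show "marginal_value n \<sigma> (penalized_game n \<sigma> x C) \<in> extensional {1..n}"
    by (simp add: marginal_value_def)
  show "x \<in> extensional {1..n}" by fact
  fix j assume "j \<in> {1..n}"
  then obtain i where i: "i \<in> {1..n}" "j = \<sigma> i" using permutes_image[OF \<sigma>] by blast
  \<comment> \<open>This turns \<open>i - 1\<close> into \<open>m\<close>; the coordinate is then a
    difference of consecutive prefix sums, free of \<open>C\<close>.\<close>
  then obtain m where "i = Suc m" by (cases i) auto
  then show "marginal_value n \<sigma> (penalized_game n \<sigma> x C) j = x j"
    using i marginal_value_perm[OF \<sigma>] penalized_game_prefix[OF \<sigma>, of i]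
      penalized_game_prefix[OF \<sigma>, of m] by simp
qed

text \<open>The constant \<open>C\<close> is explicit: its second sum absorbs the possible loss from
  \<open>x\<close>, its first dominates every single \<open>v S\<close>. Coalitions off the chain
  are thus settled by size alone, and those on it by \<open>prefix\<close>.\<close>

lemma penalized_game_core:
  assumes \<sigma>: "\<sigma> permutes {1..n}" and v: "v \<in> games n" and k: "2 \<le> k"
    and x: "x \<in> preimputations n v"
    and prefix: "\<And>i. i \<in> {1..n - 1} \<Longrightarrow> v (\<sigma> ` {1..i}) \<le> (\<Sum>j=1..i. x (\<sigma> j))"
    and C: "C = (\<Sum>S\<in>Pow {1..n}. \<bar>v S\<bar>) + (\<Sum>j\<in>{1..n}. \<bar>x (\<sigma> j)\<bar>)"
  shows "penalized_game n \<sigma> x C \<in> additive_core n k v"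
proof -
  let ?\<phi> = "penalized_game n \<sigma> x C"
  have "?\<phi> {1..n} = ?\<phi> (\<sigma> ` {1..n})" by (simp only: permutes_image[OF \<sigma>])
  also have "\<dots> = (\<Sum>j=1..n. x (\<sigma> j))" by (simp only: penalized_game_prefix[OF \<sigma> order_refl])
  also have "\<dots> = v {1..n}"
    using x sum.permute[OF \<sigma>, of x] by (simp add: preimputations_def comp_def)
  finally have total: "?\<phi> {1..n} = v {1..n}" .
  have "v S \<le> ?\<phi> S" if S: "S \<subset> {1..n}" for S
  proof (cases "\<exists>i\<in>{1..n}. \<sigma> (Suc i) \<in> S \<and> \<sigma> i \<notin> S")
    case True
    have "\<bar>v S\<bar> \<le> (\<Sum>S\<in>Pow {1..n}. \<bar>v S\<bar>)"
      using S by (intro member_le_sum) auto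
    moreover have "0 \<le> C" unfolding C by (intro add_nonneg_nonneg sum_nonneg) auto
    ultimately show ?thesis using penalized_game_ge[of C S n _ \<sigma> x] True S unfolding C by fastforce
  next
    case False
    then obtain m where m: "m \<le> n" "S = \<sigma> ` {1..m}"
      using prefix_if_downward_closed[OF \<sigma>, of S] S by blast
    have "m \<noteq> n" using m S permutes_image[OF \<sigma>] by auto
    \<comment> \<open>The empty prefix is not covered by \<open>prefix\<close>; there both games are
      0.\<close>
    then have "m = 0 \<or> m \<in> {1..n - 1}" using m(1) by auto
    then show ?thesis
      using v prefix[of m] penalized_game_prefix[OF \<sigma> m(1), of x C] unfolding m(2)
      by (auto simp: games_def)
  qed
  then show ?thesis
    using penalized_game_additive[OF k] total by (simp add: additive_core_def)
qed

theorem theorem3: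
  fixes n k :: nat and \<sigma> :: "nat \<Rightarrow> nat" and v :: "nat set \<Rightarrow> real"
  assumes "\<sigma> permutes {1..n}"
    and "v \<in> games n"
    and "2 \<le> k" and "k \<le> n"
  shows "marginal_value n \<sigma> ` additive_core n k v =
    {x \<in> preimputations n v. \<forall>i\<in>{1..n - 1}. (\<Sum>j=1..i. x (\<sigma> j)) \<ge> v (\<sigma> ` {1..i})}"
    (is "_ = ?R")
proof (intro equalityI subsetI)
  fix x assume "x \<in> marginal_value n \<sigma> ` additive_core n k v"
  then obtain \<phi> where \<phi>: "\<phi> \<in> additive_core n k v" and x: "x = marginal_value n \<sigma> \<phi>" by blast
  have "\<phi> {} = 0" using \<phi> by (simp add: additive_core_def additive_games_def games_def)
  then have sum: "(\<Sum>j=1..i. x (\<sigma> j)) = \<phi> (\<sigma> ` {1..i})" if "i \<le> n" for i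
    unfolding x using sum_marginal_value[OF assms(1)] that by blast
  \<comment> \<open>Reordering the coordinates along \<open>\<sigma>\<close> makes the total the
    prefix sum at \<open>i = n\<close>.\<close>
  have "(\<Sum>j\<in>{1..n}. x j) = (\<Sum>j=1..n. x (\<sigma> j))"
    using sum.permute[OF assms(1), of x] by (simp add: comp_def)
  also have "\<dots> = \<phi> {1..n}" by (simp only: sum[OF order_refl] permutes_image[OF assms(1)])
  also have "\<dots> = v {1..n}" using \<phi> by (simp add: additive_core_def)
  finally have "x \<in> preimputations n v"
    by (simp add: preimputations_def x marginal_value_def)
  moreover have "v (\<sigma> ` {1..i}) \<le> (\<Sum>j=1..i. x (\<sigma> j))" if "i \<in> {1..n - 1}" for i
  proof -
    have "i < n" using that by auto
    then show ?thesis
      using \<phi> sum[of i] permutes_prefix_psubset[OF assms(1)] by (simp add: additive_core_def)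
  qed
  ultimately show "x \<in> ?R" by simp
next
  fix x assume x: "x \<in> ?R"
  define C where "C = (\<Sum>S\<in>Pow {1..n}. \<bar>v S\<bar>) + (\<Sum>j\<in>{1..n}. \<bar>x (\<sigma> j)\<bar>)"
  have "penalized_game n \<sigma> x C \<in> additive_core n k v"
    using x by (intro penalized_game_core[OF assms(1-3) _ _ C_def]) auto
  \<comment> \<open>The marginals see only the chain, where the penalty is zero, so the size of
    \<open>C\<close> costs nothing here.\<close>
  moreover have "marginal_value n \<sigma> (penalized_game n \<sigma> x C) = x"
    using x by (intro marginal_value_penalized_game[OF assms(1)]) (simp add: preimputations_def)
  ultimately show "x \<in> marginal_value n \<sigma> ` additive_core n k v" by (metis image_eqI)
qed

end
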